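(* Let $n\ge2$. If $L\subseteq\mathbb{R}^n$ is a polyradial body, then the intersection body $IL\subseteq\mathbb{R}^n$ is also polyradial.
   Context: A starbody is a compact set $L\subseteq\mathbb{R}^n$ that is starshaped with respect to the origin (for each $x\in L$ the segment $[0,x]$ lies in $L$) and contains the origin in its interior. Its radial function on the unit sphere $S^{n-1}$ is $\rho_L(x)=\sup\{\lambda>0:\lambda x\in L\}$. A starbody is polyradial if its radial function is the restriction to $S^{n-1}$ of a (not necessarily homogeneous) real polynomial in $n$ variables. The intersection body $IL$ of a starbody $L\subset\mathbb{R}^n$ is the starbody with radial function \[ \rho_{IL}(x)=\operatorname{vol}_{n-1}(L\cap x^\perp)=\frac{1}{n-1}\int_{S^{n-1}\cap x^\perp}\rho_L(y)^{n-1}\,d\mu(y),\qquad x\in S^{n-1}, \] where $\mu$ here is the $(n-2)$-dimensional volume measure on the sphere $S^{n-1}\cap x^\perp$ (counting measure if $n=2$). *)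

theory Defs
  imports "HOL-Analysis.Analysis"
begin

definition starbody :: "'a::euclidean_space set \<Rightarrow> bool" where
  "starbody L \<longleftrightarrow> compact L \<and> (\<forall>x\<in>L. closed_segment 0 x \<subseteq> L) \<and> 0 \<in> interior L"

definition radial_function :: "'a::euclidean_space set \<Rightarrow> 'a \<Rightarrow> real" where
  "radial_function L x = Sup {l. 0 < l \<and> l *\<^sub>R x \<in> L}"

(* real_polynomial_function is the library's notion of a (not necessarily homogeneous)
   real polynomial: the closure of linear forms and constants under sums and products. *)
definition polyradial :: "'a::euclidean_space set \<Rightarrow> bool" where
  "polyradial L \<longleftrightarrow> starbody L \<and>
     (\<exists>p. real_polynomial_function p \<and> (\<forall>x\<in>sphere 0 1. radial_function L x = p x))"

definition orthonormal_basis_of :: "'a::euclidean_space set \<Rightarrow> 'a set \<Rightarrow> bool" where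
  "orthonormal_basis_of V B \<longleftrightarrow>
     B \<subseteq> V \<and> pairwise orthogonal B \<and> (\<forall>b\<in>B. norm b = 1) \<and> span B = V"

(* Lebesgue measure (dim V-dimensional volume) on a linear subspace V, built as lborel is built
   from the standard basis, but from an orthonormal basis of V. By rotation invariance of
   Lebesgue measure the result does not depend on the chosen basis. *)
definition subspace_lborel :: "'a::euclidean_space set \<Rightarrow> 'a measure" where
  "subspace_lborel V =
     (let B = (SOME B. orthonormal_basis_of V B)
      in distr (\<Pi>\<^sub>M b\<in>B. (lborel :: real measure)) borel (\<lambda>f. \<Sum>b\<in>B. f b *\<^sub>R b))"

definition section_volume :: "'a::euclidean_space set \<Rightarrow> 'a \<Rightarrow> real" where
  "section_volume L x =
     measure (subspace_lborel {y. x \<bullet> y = 0}) (L \<inter> {y. x \<bullet> y = 0})"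

(* The starbody whose radial function is section_volume L, given by its points in polar
   coordinates; see radial_function_intersection_body and starbody_eqI below. *)
definition intersection_body :: "'a::euclidean_space set \<Rightarrow> 'a set" where
  "intersection_body L =
     {r *\<^sub>R x | r x. norm x = 1 \<and> 0 \<le> r \<and> r \<le> section_volume L x}"

lemma orthonormal_basis_of_some:
  assumes "subspace V"
  shows "orthonormal_basis_of V (SOME B. orthonormal_basis_of V B)"
  by (rule someI_ex) (metis assms orthonormal_basis_of_def orthonormal_basis_subspace)

lemma orthonormal_basis_of_finite:
  assumes "orthonormal_basis_of V B"
  shows "finite B"
proof -
  have "0 \<notin> B" using assms by (auto simp: orthonormal_basis_of_def)
  then have "independent B"
    using assms by (intro pairwise_orthogonal_independent) (auto simp: orthonormal_basis_of_def)
  then show ?thesis by (rule independent_imp_finite)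
qed

lemma section_volume_pos:
  assumes L: "starbody L"
  shows "section_volume L x > 0"
proof -
  define V where "V = {y. x \<bullet> y = 0}"
  define B where "B = (SOME B. orthonormal_basis_of V B)"
  define g where "g = (\<lambda>f::'a \<Rightarrow> real. \<Sum>b\<in>B. f b *\<^sub>R b)"
  have V: "subspace V" unfolding V_def by (rule subspace_hyperplane)
  have B: "orthonormal_basis_of V B" unfolding B_def by (rule orthonormal_basis_of_some[OF V])
  have fin: "finite B" by (rule orthonormal_basis_of_finite[OF B])
  have n1: "norm b = 1" if "b \<in> B" for b using B that by (auto simp: orthonormal_basis_of_def)
  have orth: "b \<bullet> c = (if b = c then 1 else 0)" if "b \<in> B" "c \<in> B" for b c
    using B that by (auto simp: orthonormal_basis_of_def pairwise_def orthogonal_def dot_square_norm)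
  interpret P: finite_product_sigma_finite "\<lambda>b::'a. lborel :: real measure" B
    by standard (rule fin)
  let ?P = "\<Pi>\<^sub>M b\<in>B. (lborel :: real measure)"
  have gm: "g \<in> borel_measurable ?P" unfolding g_def by measurable
  have gV: "g f \<in> V" for f
    unfolding g_def using B V by (intro subspace_sum subspace_scale) (auto simp: orthonormal_basis_of_def)
  have cL: "compact L" using L by (simp add: starbody_def)
  have "closed V" unfolding V_def by (rule closed_hyperplane)
  then have LV: "L \<inter> V \<in> sets borel" using cL by (intro borel_closed closed_Int) (auto intro: compact_imp_closed)
  let ?A = "g -` (L \<inter> V) \<inter> space ?P"
  have A: "?A \<in> sets ?P" using measurable_sets[OF gm LV] .
  have eq: "section_volume L x = measure ?P ?A"
    unfolding section_volume_def V_def[symmetric] subspace_lborel_def Let_def B_def[symmetric]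
      g_def[symmetric] by (rule measure_distr[OF gm LV])
  obtain R where R: "\<And>y. y \<in> L \<Longrightarrow> norm y \<le> R" "R > 0"
    using compact_imp_bounded[OF cL] bounded_pos by metis
  have "?A \<subseteq> (\<Pi>\<^sub>E b\<in>B. {-R..R})"
  proof
    fix f assume f: "f \<in> ?A"
    have "f b \<in> {-R..R}" if b: "b \<in> B" for b
    proof -
      have "g f \<bullet> b = (\<Sum>c\<in>B. f c * (c \<bullet> b))" by (simp add: g_def inner_sum_left)
      also have "\<dots> = (\<Sum>c\<in>B. if c = b then f c else 0)" using b by (intro sum.cong) (auto simp: orth)
      also have "\<dots> = f b" using fin b by simp
      finally have "f b = g f \<bullet> b" by simp
      moreover have "\<bar>g f \<bullet> b\<bar> \<le> norm (g f)" using Cauchy_Schwarz_ineq2[of "g f" b] n1[OF b] by simp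
      moreover have "norm (g f) \<le> R" using R f by auto
      ultimately show ?thesis by auto
    qed
    then show "f \<in> (\<Pi>\<^sub>E b\<in>B. {-R..R})" using f by (auto simp: space_PiM PiE_def)
  qed
  then have "emeasure ?P ?A \<le> emeasure ?P (\<Pi>\<^sub>E b\<in>B. {-R..R})"
    by (rule emeasure_mono) (auto intro!: sets_PiM_I_finite fin)
  also have "\<dots> = (\<Prod>b\<in>B. emeasure lborel {-R..R})" by (rule P.measure_times) auto
  also have "\<dots> < \<infinity>" using R(2) by (simp add: ennreal_power[symmetric] power_less_top_ennreal)
  finally have top: "emeasure ?P ?A < \<infinity>" .
  obtain e where e: "e > 0" "ball 0 e \<subseteq> L"
    using L unfolding starbody_def mem_interior by auto
  define c where "c = e / (real (card B) + 1)"
  have c: "c > 0" "real (card B) * c < e" using e(1) by (auto simp: c_def field_simps)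
  have "(\<Pi>\<^sub>E b\<in>B. {0..c}) \<subseteq> ?A"
  proof
    fix f assume f: "f \<in> (\<Pi>\<^sub>E b\<in>B. {0..c})"
    have "norm (g f) \<le> (\<Sum>b\<in>B. norm (f b *\<^sub>R b))" unfolding g_def by (rule norm_sum)
    also have "\<dots> \<le> (\<Sum>b\<in>B. c)" using f by (intro sum_mono) (auto simp: n1 PiE_def Pi_def)
    also have "\<dots> < e" using c by simp
    finally have "g f \<in> L" using e(2) by (auto simp: subset_eq)
    then show "f \<in> ?A" using f gV by (auto simp: space_PiM PiE_def)
  qed
  then have "emeasure ?P (\<Pi>\<^sub>E b\<in>B. {0..c}) \<le> emeasure ?P ?A"
    using A by (rule emeasure_mono)
  moreover have "emeasure ?P (\<Pi>\<^sub>E b\<in>B. {0..c}) = (\<Prod>b\<in>B. emeasure lborel {0..c})"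
    by (rule P.measure_times) auto
  moreover have "(\<Prod>b\<in>B. emeasure lborel {0..c}) > 0" using c(1) by (simp add: ennreal_power)
  ultimately have "emeasure ?P ?A > 0" by auto
  then show ?thesis using top eq by (simp add: measure_def enn2real_positive_iff)
qed

theorem radial_function_intersection_body:
  assumes L: "starbody L" and x: "norm x = 1"
  shows "radial_function (intersection_body L) x = section_volume L x"
proof -
  have sym: "section_volume L (-y) = section_volume L y" for y by (simp add: section_volume_def)
  have "l *\<^sub>R x \<in> intersection_body L \<longleftrightarrow> l \<le> section_volume L x" if l: "l > 0" for l
  proof
    assume "l *\<^sub>R x \<in> intersection_body L"
    then obtain r y where ry: "l *\<^sub>R x = r *\<^sub>R y" "norm y = 1" "0 \<le> r" "r \<le> section_volume L y"
      by (auto simp: intersection_body_def)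
    have "norm (l *\<^sub>R x) = norm (r *\<^sub>R y)" using ry by simp
    then have "l = r" using ry(2,3) x l by (simp only: norm_scaleR)
    then show "l \<le> section_volume L x" using ry l by simp
  next
    assume "l \<le> section_volume L x"
    then show "l *\<^sub>R x \<in> intersection_body L"
      using l x by (auto simp: intersection_body_def intro!: exI[of _ l] exI[of _ x])
  qed
  then have "{l. 0 < l \<and> l *\<^sub>R x \<in> intersection_body L} = {0<..section_volume L x}" by auto
  then show ?thesis
    unfolding radial_function_def using section_volume_pos[OF L] by simp
qed

lemma starbody_mem_iff:
  assumes L: "starbody L" and x: "norm x = 1" and l: "l > 0"
  shows "l *\<^sub>R x \<in> L \<longleftrightarrow> l \<le> radial_function L x"
proof -
  let ?S = "{l. 0 \<le> l \<and> l *\<^sub>R x \<in> L}" and ?T = "{l. 0 < l \<and> l *\<^sub>R x \<in> L}"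
  have cL: "compact L" using L by (simp add: starbody_def)
  obtain R where R: "\<And>y. y \<in> L \<Longrightarrow> norm y \<le> R"
    using compact_imp_bounded[OF cL] bounded_pos by metis
  have bd: "l \<le> R" if "l *\<^sub>R x \<in> L" "l \<ge> 0" for l using R[OF that(1)] that(2) x by simp
  have bdd: "bdd_above ?T" "bdd_above ?S" using bd by (auto intro!: bdd_aboveI[of _ R])
  obtain e where e: "e > 0" "ball 0 e \<subseteq> L"
    using L unfolding starbody_def mem_interior by auto
  have "(e/2) *\<^sub>R x \<in> L" using e x by (auto simp: subset_eq)
  then have T: "e/2 \<in> ?T" using e by auto
  have "?S = insert 0 ?T" using e by (auto simp: subset_eq)
  moreover have "Sup (insert 0 ?T) = Sup ?T"
    proof (subst cSup_insert)
    show "?T \<noteq> {}" using T by blast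
    show "sup 0 (Sup ?T) = Sup ?T"
      using cSup_upper[OF T bdd(1)] e(1) by (simp add: sup_max)
  qed (rule bdd(1))
  ultimately have rf: "radial_function L x = Sup ?S" by (simp add: radial_function_def)
  have "closed ({0..} \<inter> (\<lambda>l. l *\<^sub>R x) -` L)"
    using cL by (intro closed_Int closed_vimage compact_imp_closed continuous_intros) auto
  moreover have "{0..} \<inter> (\<lambda>l. l *\<^sub>R x) -` L = ?S" by auto
  ultimately have "closed ?S" by simp
  then have "Sup ?S \<in> ?S" using T bdd by (intro closed_contains_Sup) (auto intro!: exI[of _ "e/2"])
  then have m: "radial_function L x *\<^sub>R x \<in> L" by (simp add: rf)
  show ?thesis
  proof
    assume "l *\<^sub>R x \<in> L"
    then show "l \<le> radial_function L x"
      unfolding radial_function_def using l bdd by (intro cSup_upper) auto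
  next
    assume le: "l \<le> radial_function L x"
    have "l *\<^sub>R x = (l / radial_function L x) *\<^sub>R (radial_function L x *\<^sub>R x)" using le l by simp
    moreover have "0 \<le> l / radial_function L x" "l / radial_function L x \<le> 1" using le l by auto
    ultimately have "l *\<^sub>R x \<in> closed_segment 0 (radial_function L x *\<^sub>R x)"
      by (metis (no_types, lifting) in_segment(1) scaleR_zero_right add_0)
    then show "l *\<^sub>R x \<in> L" using L m by (auto simp: starbody_def)
  qed
qed

theorem starbody_eqI:
  assumes K: "starbody K" and L: "starbody L"
    and eq: "\<And>x. norm x = 1 \<Longrightarrow> radial_function K x = radial_function L x"
  shows "K = L"
proof (rule set_eqI)
  fix y :: 'a
  show "y \<in> K \<longleftrightarrow> y \<in> L"
  proof (cases "y = 0")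
    case True
    then show ?thesis using K L interior_subset by (auto simp: starbody_def)
  next
    case False
    then have y: "y = norm y *\<^sub>R sgn y" "norm (sgn y) = 1" "norm y > 0" by (auto simp: sgn_div_norm)
    show ?thesis
      using starbody_mem_iff[OF K y(2,3)] starbody_mem_iff[OF L y(2,3)] eq[OF y(2)] y(1) by simp
  qed
qed

end

theory Submission
  imports Defs
begin

text \<open>Let \<open>V\<close> be the hyperplane orthogonal to the unit vector \<open>x\<close>. In polar coordinates on \<open>V\<close>, the section volume is the integral of \<open>q (sgn z)\<close> over the unit ball
  of \<open>V\<close>, where \<open>q\<close> is the \<open>(n - 1)\<close>-st power of the polynomial giving the radial function.
  Split \<open>q\<close> into homogeneous parts \<open>h\<close>. For \<open>h\<close> homogeneous of degree \<open>k\<close>, integrating \<open>h (y - (x \<bullet> y) x)\<close>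
  over the unit ball of the whole space (first along \<open>x\<close>, then in polar coordinates on \<open>V\<close>) gives the
  integral of \<open>h (sgn z)\<close> over the unit ball of \<open>V\<close> times a positive constant depending only on
  \<open>n\<close> and \<open>k\<close>. The domain of the former integral does not depend on \<open>x\<close> and its integrand is a polynomial
  in \<open>x\<close> and \<open>y\<close>, so it is a polynomial in \<open>x\<close>.\<close>

subsection \<open>Invariance of Lebesgue measure under orthogonal maps\<close>

lemma nn_integral_lborel_translation:
  fixes a :: "'a::euclidean_space"
  assumes [measurable]: "F \<in> borel_measurable borel"
  shows "(\<integral>\<^sup>+y. F (a + y) \<partial>lborel) = (\<integral>\<^sup>+y. F y \<partial>lborel)"
proof -
  have "(\<integral>\<^sup>+y. F y \<partial>lborel) = (\<integral>\<^sup>+y. F y \<partial>distr lborel borel ((+) a))"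
    by (simp add: lborel_distr_plus)
  then show ?thesis by (simp add: nn_integral_distr)
qed

text \<open>Both sides are translation invariant and agree on the unit ball; Fubini applied to
  \<open>F (f x) * indicator (cball 0 1) y\<close> turns one into the other.\<close>

lemma nn_integral_lborel_orthogonal:
  fixes f :: "'a::euclidean_space \<Rightarrow> 'a"
  assumes f: "orthogonal_transformation f" and F [measurable]: "F \<in> borel_measurable borel"
  shows "(\<integral>\<^sup>+x. F (f x) \<partial>lborel) = (\<integral>\<^sup>+x. F x \<partial>lborel)"
proof -
  have [measurable]: "f \<in> borel_measurable borel"
    using orthogonal_transformation_linear[OF f]
    by (intro borel_measurable_continuous_onI linear_continuous_on) (simp add: linear_conv_bounded_linear)
  define C where "C = (indicator (cball 0 1) :: 'a \<Rightarrow> ennreal)"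
  have [measurable]: "C \<in> borel_measurable borel"
    unfolding C_def by (rule borel_measurable_indicator) simp
  define c where "c = (\<integral>\<^sup>+y. C y \<partial>(lborel :: 'a measure))"
  have c_eq: "c = emeasure lborel (cball (0 :: 'a) 1)" by (simp add: c_def C_def)
  \<comment> \<open>The last line cancels the factor \<open>c\<close> in \<open>ennreal\<close>, so
    \<open>c\<close> has to be neither zero nor infinite.\<close>
  have "emeasure lborel (ball (0 :: 'a) 1) \<le> c" unfolding c_eq by (intro emeasure_mono) auto
  moreover have "emeasure lborel (ball (0 :: 'a) 1) \<noteq> 0"
  proof
    assume "emeasure lborel (ball (0 :: 'a) 1) = 0"
    then have "ball (0 :: 'a) 1 \<in> null_sets lborel" by auto
    then show False using open_not_negligible[of "ball (0 :: 'a) 1"]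
      by (auto simp: negligible_iff_null_sets dest: null_sets_completionI)
  qed
  moreover have "c < \<infinity>" unfolding c_eq by (intro emeasure_bounded_finite bounded_cball)
  ultimately have c: "c \<noteq> 0" "c \<noteq> \<infinity>" by auto
  \<comment> \<open>Since \<open>f\<close> is onto and preserves norms, \<open>y = f a\<close> turns
    \<open>C (y - f x)\<close> into a translate of \<open>C\<close> in \<open>x\<close>.\<close>
  have inner: "(\<integral>\<^sup>+x. C (y - f x) \<partial>lborel) = c" for y
  proof -
    obtain a where a: "y = f a" using orthogonal_transformation_surj[OF f] by (metis surjD)
    have "C (y - f x) = C (- a + x)" for x
    proof -
      have "norm (y - f x) = norm (f (a - x))"
        using orthogonal_transformation_linear[OF f] by (simp add: a linear_diff)
      then show ?thesis
        by (simp add: C_def indicator_def orthogonal_transformation_norm[OF f] norm_minus_commute)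
    qed
    then show ?thesis using nn_integral_lborel_translation[of C "- a"] by (simp add: c_def)
  qed
  have "c * (\<integral>\<^sup>+x. F (f x) \<partial>lborel) = (\<integral>\<^sup>+y. C y * (\<integral>\<^sup>+x. F (f x) \<partial>lborel) \<partial>lborel)"
    by (simp add: c_def nn_integral_multc)
  also have "\<dots> = (\<integral>\<^sup>+y. \<integral>\<^sup>+x. C y * F (y + f x) \<partial>lborel \<partial>lborel)"
  proof (intro nn_integral_cong)
    fix y
    obtain a where a: "y = f a" using orthogonal_transformation_surj[OF f] by (metis surjD)
    have "(\<integral>\<^sup>+x. F (y + f x) \<partial>lborel) = (\<integral>\<^sup>+x. F (f (a + x)) \<partial>lborel)"
      using orthogonal_transformation_linear[OF f] by (simp add: a linear_add)
    also have "\<dots> = (\<integral>\<^sup>+x. F (f x) \<partial>lborel)"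
      by (rule nn_integral_lborel_translation) measurable
    finally show "C y * (\<integral>\<^sup>+x. F (f x) \<partial>lborel) = (\<integral>\<^sup>+x. C y * F (y + f x) \<partial>lborel)"
      by (simp add: nn_integral_cmult)
  qed
  also have "\<dots> = (\<integral>\<^sup>+x. \<integral>\<^sup>+y. C y * F (y + f x) \<partial>lborel \<partial>lborel)"
    by (rule lborel_pair.Fubini') measurable
  also have "\<dots> = (\<integral>\<^sup>+x. \<integral>\<^sup>+y. C (y - f x) * F y \<partial>lborel \<partial>lborel)"
  proof (rule nn_integral_cong)
    fix x
    show "(\<integral>\<^sup>+y. C y * F (y + f x) \<partial>lborel) = (\<integral>\<^sup>+y. C (y - f x) * F y \<partial>lborel)"
      using nn_integral_lborel_translation[of "\<lambda>y. C (y - f x) * F y" "f x"] by (simp add: add.commute)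
  qed
  also have "\<dots> = (\<integral>\<^sup>+y. \<integral>\<^sup>+x. C (y - f x) * F y \<partial>lborel \<partial>lborel)"
    by (rule lborel_pair.Fubini') measurable
  also have "\<dots> = c * (\<integral>\<^sup>+x. F x \<partial>lborel)"
    by (simp add: nn_integral_multc inner nn_integral_cmult)
  finally show ?thesis using c by (simp add: ennreal_mult_cancel_left)
qed

lemma lborel_distr_orthogonal:
  fixes f :: "'a::euclidean_space \<Rightarrow> 'a"
  assumes f: "orthogonal_transformation f"
  shows "distr lborel borel f = lborel"
proof (rule measure_eqI)
  have "f \<in> borel_measurable borel"
    using orthogonal_transformation_linear[OF f]
    by (intro borel_measurable_continuous_onI linear_continuous_on) (simp add: linear_conv_bounded_linear)
  then have m: "f \<in> borel_measurable lborel" by simp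
  fix A assume "A \<in> sets (distr lborel borel f)"
  then have A: "A \<in> sets borel" by simp
  have "emeasure (distr lborel borel f) A = (\<integral>\<^sup>+x. indicator A x \<partial>distr lborel borel f)"
    using A by simp
  also have "\<dots> = (\<integral>\<^sup>+x. indicator A (f x) \<partial>lborel)"
    using A m by (subst nn_integral_distr) auto
  also have "\<dots> = emeasure lborel A"
    using A by (subst nn_integral_lborel_orthogonal[OF f]) auto
  finally show "emeasure (distr lborel borel f) A = emeasure lborel A" .
qed simp

text \<open>This is independence of the basis when the subspace is the whole space. The map factors
  as \<open>T \<circ> h\<close>: \<open>h\<close> relabels the coordinates along a bijection from
  \<open>Basis\<close> to \<open>B\<close>, so it yields \<open>lborel\<close> by comparing boxes,
  and \<open>T\<close> is the orthogonal map carrying \<open>Basis\<close> to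
  \<open>B\<close>.\<close>

lemma distr_PiM_lborel_orthonormal:
  fixes B :: "'a::euclidean_space set"
  assumes B: "orthonormal_basis_of UNIV B"
  shows "distr (\<Pi>\<^sub>M b\<in>B. (lborel :: real measure)) borel (\<lambda>f. \<Sum>b\<in>B. f b *\<^sub>R b) = lborel"
proof -
  have fin: "finite B" by (rule orthonormal_basis_of_finite[OF B])
  have orth: "b \<bullet> c = (if b = c then 1 else 0)" if "b \<in> B" "c \<in> B" for b c
    using B that by (auto simp: orthonormal_basis_of_def pairwise_def orthogonal_def dot_square_norm)
  have "0 \<notin> B" using B by (auto simp: orthonormal_basis_of_def)
  then have "independent B"
    using B by (intro pairwise_orthogonal_independent) (auto simp: orthonormal_basis_of_def)
  then have "card B = card (Basis :: 'a set)"
    using B by (metis orthonormal_basis_of_def dim_UNIV dim_span dim_eq_card_independent)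
  then obtain \<phi> where \<phi>: "bij_betw \<phi> (Basis :: 'a set) B"
    using fin by (metis finite_Basis finite_same_card_bij)
  let ?P = "\<Pi>\<^sub>M b\<in>B. (lborel :: real measure)"
  interpret P: finite_product_sigma_finite "\<lambda>b :: 'a. lborel :: real measure" B
    by standard (rule fin)
  define T where "T v = (\<Sum>i\<in>Basis. (v \<bullet> i) *\<^sub>R \<phi> i)" for v :: "'a"
  define h where "h f = (\<Sum>i\<in>Basis. f (\<phi> i) *\<^sub>R i)" for f :: "'a \<Rightarrow> real"
  have \<phi>B: "\<phi> i \<in> B" if "i \<in> Basis" for i using \<phi> that by (auto simp: bij_betw_def)
  have orth\<phi>: "\<phi> i \<bullet> \<phi> j = (if i = j then 1 else 0)" if "i \<in> Basis" "j \<in> Basis" for i j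
    using \<phi> that orth[OF \<phi>B \<phi>B] by (auto simp: bij_betw_def inj_on_def)
  have "linear T" unfolding T_def
    by (rule linearI) (simp_all add: inner_add_left scaleR_add_left sum.distrib scaleR_sum_right)
  moreover have "T v \<bullet> T w = v \<bullet> w" for v w
  proof -
    have "T v \<bullet> T w = (\<Sum>i\<in>Basis. \<Sum>j\<in>Basis. (v \<bullet> i) * ((w \<bullet> j) * (\<phi> i \<bullet> \<phi> j)))"
      by (simp only: T_def inner_sum_left)
         (simp add: inner_sum_right sum_distrib_left mult.left_commute)
    also have "\<dots> = (\<Sum>i\<in>Basis. \<Sum>j\<in>Basis. if i = j then (v \<bullet> i) * (w \<bullet> j) else 0)"
      by (intro sum.cong) (auto simp: orth\<phi>)
    also have "\<dots> = v \<bullet> w" by (simp add: euclidean_inner[of v w])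
    finally show ?thesis .
  qed
  ultimately have T: "orthogonal_transformation T" by (simp add: orthogonal_transformation_def)
  have Tm: "T \<in> borel_measurable borel" unfolding T_def by measurable
  have hm: "h \<in> borel_measurable ?P" unfolding h_def
  proof (intro borel_measurable_sum borel_measurable_scaleR)
    fix i :: "'a" assume "i \<in> Basis"
    then show "(\<lambda>f. f (\<phi> i)) \<in> borel_measurable ?P"
      using measurable_component_singleton[OF \<phi>B, of i "\<lambda>_. lborel"] by simp
  qed auto
  have h_i: "h f \<bullet> i = f (\<phi> i)" if "i \<in> Basis" for f i
    using that by (simp add: h_def inner_sum_left inner_Basis if_distrib cong: if_cong)
  have "distr ?P borel h = lborel"
  proof (rule lborel_eqI[symmetric])
    fix l u :: "'a" assume le: "\<And>b. b \<in> Basis \<Longrightarrow> l \<bullet> b \<le> u \<bullet> b"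
    let ?\<psi> = "the_inv_into Basis \<phi>"
    have \<psi>: "?\<psi> (\<phi> i) = i" if "i \<in> Basis" for i
      using \<phi> that by (simp add: bij_betw_def the_inv_into_f_f)
    have all: "(\<forall>b\<in>B. Q b) \<longleftrightarrow> (\<forall>i\<in>Basis. Q (\<phi> i))" for Q
      using \<phi> by (auto simp: bij_betw_def)
    have "h -` box l u \<inter> space ?P = (\<Pi>\<^sub>E b\<in>B. {l \<bullet> ?\<psi> b <..< u \<bullet> ?\<psi> b})"
    proof (intro set_eqI)
      fix f
      show "f \<in> h -` box l u \<inter> space ?P \<longleftrightarrow> f \<in> (\<Pi>\<^sub>E b\<in>B. {l \<bullet> ?\<psi> b <..< u \<bullet> ?\<psi> b})"
        by (simp add: box_def h_i space_PiM PiE_def Pi_iff all \<psi> cong: ball_cong)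
    qed
    then have "emeasure (distr ?P borel h) (box l u) = emeasure ?P (\<Pi>\<^sub>E b\<in>B. {l \<bullet> ?\<psi> b <..< u \<bullet> ?\<psi> b})"
      by (subst emeasure_distr[OF hm]) auto
    also have "\<dots> = (\<Prod>b\<in>B. emeasure lborel {l \<bullet> ?\<psi> b <..< u \<bullet> ?\<psi> b})"
      by (rule P.measure_times) auto
    also have "\<dots> = (\<Prod>i\<in>Basis. emeasure lborel {l \<bullet> i <..< u \<bullet> i})"
      by (subst prod.reindex_bij_betw[OF \<phi>, symmetric]) (simp add: \<psi>)
    also have "\<dots> = (\<Prod>i\<in>Basis. ennreal ((u - l) \<bullet> i))"
      using le by (intro prod.cong) (auto simp: inner_diff_left)
    also have "\<dots> = (\<Prod>b\<in>Basis. (u - l) \<bullet> b)"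
      using le by (intro prod_ennreal) (auto simp: inner_diff_left)
    finally show "emeasure (distr ?P borel h) (box l u) = (\<Prod>b\<in>Basis. (u - l) \<bullet> b)" .
  qed simp
  then have "lborel = distr (distr ?P borel h) borel T" by (simp add: lborel_distr_orthogonal[OF T])
  also have "\<dots> = distr ?P borel (T \<circ> h)" by (rule distr_distr[OF Tm hm])
  also have "T \<circ> h = (\<lambda>f. \<Sum>b\<in>B. f b *\<^sub>R b)"
    by (rule ext) (simp add: T_def h_i sum.reindex_bij_betw[OF \<phi>, of "\<lambda>b. _ b *\<^sub>R b", symmetric])
  finally show ?thesis by simp
qed

subsection \<open>Lebesgue measure on hyperplanes\<close>

lemma orthonormal_basis_of_insert_normal:
  assumes x: "norm x = 1" and B: "orthonormal_basis_of {y. x \<bullet> y = 0} B"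
  shows "orthonormal_basis_of UNIV (insert x B)" "x \<notin> B"
proof -
  have B': "x \<bullet> b = 0" if "b \<in> B" for b using B that by (auto simp: orthonormal_basis_of_def)
  have xx: "x \<bullet> x = 1" using x by (simp add: dot_square_norm)
  then show "x \<notin> B" using B' by force
  have "y \<in> span (insert x B)" for y
  proof -
    have "x \<bullet> (y - (x \<bullet> y) *\<^sub>R x) = 0" by (simp add: inner_diff_right xx)
    then have "y - (x \<bullet> y) *\<^sub>R x \<in> span B" using B by (auto simp: orthonormal_basis_of_def)
    then show ?thesis by (auto simp: span_insert)
  qed
  then show "orthonormal_basis_of UNIV (insert x B)"
    using B B' x by (auto simp: orthonormal_basis_of_def pairwise_insert orthogonal_def inner_commute)
qed

abbreviation hyperplane_lborel :: "'a::euclidean_space \<Rightarrow> 'a measure" where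
  "hyperplane_lborel x \<equiv> subspace_lborel {y. x \<bullet> y = 0}"

lemma sets_subspace_lborel [measurable_cong]: "sets (subspace_lborel V) = sets borel"
  by (simp add: subspace_lborel_def Let_def)

text \<open>\<open>subspace_lborel\<close> is a measure on the whole ambient space, so its
  concentration on the hyperplane has to be recovered from the basis vectors, all orthogonal to
  \<open>x\<close>.\<close>

lemma AE_hyperplane_lborel: "AE z in hyperplane_lborel x. x \<bullet> z = 0"
proof -
  define B where "B = (SOME B. orthonormal_basis_of {y. x \<bullet> y = 0} B)"
  have "orthonormal_basis_of {y. x \<bullet> y = 0} B"
    unfolding B_def by (rule orthonormal_basis_of_some[OF subspace_hyperplane])
  then have "x \<bullet> b = 0" if "b \<in> B" for b using that by (auto simp: orthonormal_basis_of_def)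
  moreover have "(\<lambda>f. \<Sum>b\<in>B. f b *\<^sub>R b) \<in> borel_measurable (\<Pi>\<^sub>M b\<in>B. (lborel :: real measure))"
    by measurable
  ultimately show ?thesis unfolding subspace_lborel_def Let_def B_def[symmetric]
    by (subst AE_distr_iff) (auto simp: inner_sum_right)
qed

text \<open>Fubini in the direction \<open>x\<close>: adjoining \<open>x\<close> to the chosen
  orthonormal basis of the hyperplane gives an orthonormal basis of the whole space, and the
  coordinate of \<open>x\<close> is split off the resulting product measure.\<close>

lemma nn_integral_lborel_hyperplane:
  assumes x: "norm x = 1" and F [measurable]: "F \<in> borel_measurable borel"
  shows "(\<integral>\<^sup>+Y. F Y \<partial>lborel) = (\<integral>\<^sup>+z. \<integral>\<^sup>+t. F (z + t *\<^sub>R x) \<partial>lborel \<partial>hyperplane_lborel x)"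
proof -
  define B where "B = (SOME B. orthonormal_basis_of {y. x \<bullet> y = 0} B)"
  have B: "orthonormal_basis_of {y. x \<bullet> y = 0} B"
    unfolding B_def by (rule orthonormal_basis_of_some[OF subspace_hyperplane])
  note fin = orthonormal_basis_of_finite[OF B] and nx = orthonormal_basis_of_insert_normal(2)[OF x B]
  interpret P: product_sigma_finite "\<lambda>b :: 'a. lborel :: real measure" by standard
  let ?P = "\<lambda>B. \<Pi>\<^sub>M b\<in>B. (lborel :: real measure)"
  let ?g = "\<lambda>B f. \<Sum>b\<in>B. f b *\<^sub>R (b :: 'a)"
  have [measurable]: "?g B \<in> borel_measurable (?P B)" for B by measurable
  have "(\<integral>\<^sup>+Y. F Y \<partial>lborel) = (\<integral>\<^sup>+Y. F Y \<partial>distr (?P (insert x B)) borel (?g (insert x B)))"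
    by (simp add: distr_PiM_lborel_orthonormal[OF orthonormal_basis_of_insert_normal(1)[OF x B]])
  also have "\<dots> = (\<integral>\<^sup>+f. F (?g (insert x B) f) \<partial>?P (insert x B))"
    by (rule nn_integral_distr) measurable
  also have "\<dots> = (\<integral>\<^sup>+f. \<integral>\<^sup>+t. F (?g (insert x B) (f(x := t))) \<partial>lborel \<partial>?P B)"
    by (rule P.product_nn_integral_insert[OF fin nx]) measurable
  also have "\<dots> = (\<integral>\<^sup>+f. \<integral>\<^sup>+t. F (?g B f + t *\<^sub>R x) \<partial>lborel \<partial>?P B)"
  proof (intro nn_integral_cong)
    fix f t
    have "?g B (f(x := t)) = ?g B f" using nx by (intro sum.cong) auto
    then show "F (?g (insert x B) (f(x := t))) = F (?g B f + t *\<^sub>R x)"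
      using fin nx by (simp add: add.commute)
  qed
  also have "\<dots> = (\<integral>\<^sup>+z. \<integral>\<^sup>+t. F (z + t *\<^sub>R x) \<partial>lborel \<partial>distr (?P B) borel (?g B))"
    by (rule nn_integral_distr[symmetric]) measurable
  finally show ?thesis by (simp add: subspace_lborel_def Let_def B_def)
qed

text \<open>For \<open>z\<close> orthogonal to \<open>x\<close>, the point
  \<open>z + t *\<^sub>R x\<close> has projection \<open>z\<close> and coordinate \<open>t\<close>;
  almost every \<open>z\<close> is of this kind.\<close>

lemma nn_integral_lborel_hyperplane_proj:
  fixes x :: "'a::euclidean_space"
  assumes x: "norm x = 1" and [measurable]: "case_prod G \<in> borel_measurable (borel \<Otimes>\<^sub>M borel)"
  shows "(\<integral>\<^sup>+y. G (y - (x \<bullet> y) *\<^sub>R x) (x \<bullet> y) \<partial>lborel) =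
    (\<integral>\<^sup>+z. \<integral>\<^sup>+t. G z t \<partial>lborel \<partial>hyperplane_lborel x)"
proof -
  have "(\<integral>\<^sup>+y. G (y - (x \<bullet> y) *\<^sub>R x) (x \<bullet> y) \<partial>lborel) = (\<integral>\<^sup>+z. \<integral>\<^sup>+t.
      G (z + t *\<^sub>R x - (x \<bullet> (z + t *\<^sub>R x)) *\<^sub>R x) (x \<bullet> (z + t *\<^sub>R x)) \<partial>lborel \<partial>hyperplane_lborel x)"
    by (rule nn_integral_lborel_hyperplane[OF x]) measurable
  also have "\<dots> = (\<integral>\<^sup>+z. \<integral>\<^sup>+t. G z t \<partial>lborel \<partial>hyperplane_lborel x)"
    by (rule nn_integral_cong_AE, rule eventually_mono[OF AE_hyperplane_lborel[of x]])
       (simp add: inner_add_right dot_square_norm x)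
  finally show ?thesis .
qed

text \<open>Writing a hyperplane integral as an integral over a slab of thickness \<open>s\<close>
  lets scaling and finiteness be inherited from \<open>lborel\<close>.\<close>

lemma nn_integral_lborel_cylinder:
  fixes x :: "'a::euclidean_space"
  assumes x: "norm x = 1" and [measurable]: "F \<in> borel_measurable borel" and "0 \<le> s"
  shows "(\<integral>\<^sup>+y. F (y - (x \<bullet> y) *\<^sub>R x) * indicator {0..s} (x \<bullet> y) \<partial>lborel) =
    ennreal s * (\<integral>\<^sup>+z. F z \<partial>hyperplane_lborel x)"
  using nn_integral_lborel_hyperplane_proj[OF x, of "\<lambda>z t. F z * indicator {0..s} t"] \<open>0 \<le> s\<close>
  by (simp add: nn_integral_cmult nn_integral_multc mult.commute)

text \<open>Scaling the whole space maps the slab of thickness 1 to the slab of thickness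
  \<open>s\<close>. The factor is \<open>s ^ DIM('a)\<close>, and one power of \<open>s\<close> is
  accounted for by the thickness, which leaves the dimension of the hyperplane as exponent.\<close>

lemma nn_integral_hyperplane_lborel_scale:
  fixes x :: "'a::euclidean_space"
  assumes x: "norm x = 1" and [measurable]: "F \<in> borel_measurable borel" and s: "0 < s"
  shows "ennreal (s ^ (DIM('a) - 1)) * (\<integral>\<^sup>+z. F (s *\<^sub>R z) \<partial>hyperplane_lborel x) =
    (\<integral>\<^sup>+z. F z \<partial>hyperplane_lborel x)"
proof -
  let ?H = "\<lambda>y. F (y - (x \<bullet> y) *\<^sub>R x) * indicator {0..s} (x \<bullet> y)"
  have "ennreal s * (\<integral>\<^sup>+z. F z \<partial>hyperplane_lborel x) = (\<integral>\<^sup>+y. ?H y \<partial>lborel)"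
    using nn_integral_lborel_cylinder[OF x, of F s] s by simp
  also have "\<dots> = (\<integral>\<^sup>+y. ?H y \<partial>density (distr lborel borel (\<lambda>y. 0 + s *\<^sub>R y)) (\<lambda>_. \<bar>s\<bar> ^ DIM('a)))"
    using s by (subst lborel_affine[of s 0]) simp_all
  also have "\<dots> = ennreal (s ^ DIM('a)) * (\<integral>\<^sup>+y. ?H (s *\<^sub>R y) \<partial>lborel)"
    using s by (simp add: nn_integral_density nn_integral_distr nn_integral_cmult)
  also have "(\<lambda>y. ?H (s *\<^sub>R y)) =
      (\<lambda>y. F (s *\<^sub>R (y - (x \<bullet> y) *\<^sub>R x)) * indicator {0..1} (x \<bullet> y))"
    using s by (auto simp: fun_eq_iff indicator_def algebra_simps mult_le_cancel_left1 zero_le_mult_iff)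
  also have "(\<integral>\<^sup>+y. F (s *\<^sub>R (y - (x \<bullet> y) *\<^sub>R x)) * indicator {0..1} (x \<bullet> y) \<partial>lborel) =
      (\<integral>\<^sup>+z. F (s *\<^sub>R z) \<partial>hyperplane_lborel x)"
    using nn_integral_lborel_cylinder[OF x, of "\<lambda>y. F (s *\<^sub>R y)" 1] by simp
  also have "ennreal (s ^ DIM('a)) = ennreal s * ennreal (s ^ (DIM('a) - 1))"
    using s by (simp add: ennreal_mult'[symmetric] power_eq_if)
  finally show ?thesis
    using s by (simp add: mult.assoc ennreal_mult_cancel_left)
qed

text \<open>The part of the slab of thickness 1 that projects into the ball lies in the ball of
  radius \<open>r + 1\<close>, by the triangle inequality.\<close>

lemma emeasure_hyperplane_lborel_cball:
  fixes x :: "'a::euclidean_space"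
  assumes x: "norm x = 1"
  shows "emeasure (hyperplane_lborel x) (cball 0 r) < \<infinity>"
proof -
  have "emeasure (hyperplane_lborel x) (cball 0 r) =
      (\<integral>\<^sup>+y. indicator (cball 0 r) (y - (x \<bullet> y) *\<^sub>R x) * indicator {0..1} (x \<bullet> y) \<partial>lborel)"
    using nn_integral_lborel_cylinder[OF x, of "indicator (cball 0 r)" 1]
    by (simp add: sets_subspace_lborel borel_measurable_indicator)
  also have "\<dots> \<le> (\<integral>\<^sup>+y. indicator (cball (0::'a) (r + 1)) y \<partial>lborel)"
  proof (intro nn_integral_mono)
    fix y :: 'a
    have "norm y \<le> norm (y - (x \<bullet> y) *\<^sub>R x) + norm ((x \<bullet> y) *\<^sub>R x)"
      using norm_triangle_ineq[of "y - (x \<bullet> y) *\<^sub>R x" "(x \<bullet> y) *\<^sub>R x"] by simp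
    then show "indicator (cball 0 r) (y - (x \<bullet> y) *\<^sub>R x) * indicator {0..1} (x \<bullet> y) \<le>
        (indicator (cball 0 (r + 1)) y :: ennreal)"
      using x by (auto simp: indicator_def)
  qed
  also have "\<dots> < \<infinity>" using emeasure_bounded_finite[OF bounded_cball, of "0::'a" "r + 1"] by simp
  finally show ?thesis .
qed

lemma sigma_finite_hyperplane_lborel:
  fixes x :: "'a::euclidean_space"
  assumes x: "norm x = 1"
  shows "sigma_finite_measure (hyperplane_lborel x)"
proof
  have "(\<Union>n. cball 0 (real n)) = (UNIV :: 'a set)" using real_arch_simple by auto
  then show "\<exists>A. countable A \<and> A \<subseteq> sets (hyperplane_lborel x) \<and> \<Union> A = space (hyperplane_lborel x)
      \<and> (\<forall>a\<in>A. emeasure (hyperplane_lborel x) a \<noteq> \<infinity>)"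
    using emeasure_hyperplane_lborel_cball[OF x]
    by (intro exI[of _ "range (\<lambda>n. cball 0 (real n))"])
       (auto simp: sets_subspace_lborel sets_eq_imp_space_eq[OF sets_subspace_lborel] less_top)
qed

text \<open>Doubling fixes the origin but multiplies volume by \<open>2 ^ (DIM('a) - 1)\<close>, so
  the finite mass of the origin vanishes. In dimension 1 the exponent is 0, and the hyperplane is a
  single point of mass 1.\<close>

lemma AE_hyperplane_lborel_nonzero:
  fixes x :: "'a::euclidean_space"
  assumes x: "norm x = 1" and n: "DIM('a) \<ge> 2"
  shows "AE z in hyperplane_lborel x. z \<noteq> 0"
proof -
  let ?e = "emeasure (hyperplane_lborel x) {0}"
  have "emeasure (hyperplane_lborel x) {0} \<le> emeasure (hyperplane_lborel x) (cball 0 1)"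
    by (intro emeasure_mono) (auto simp: sets_subspace_lborel)
  then have fin: "?e < \<infinity>"
    using emeasure_hyperplane_lborel_cball[OF x, of 1] by (rule le_less_trans)
  have "ennreal (2 ^ (DIM('a) - 1)) * (\<integral>\<^sup>+z. indicator {0} (2 *\<^sub>R z) \<partial>hyperplane_lborel x) =
    (\<integral>\<^sup>+z. indicator {0} z \<partial>hyperplane_lborel x)"
    by (rule nn_integral_hyperplane_lborel_scale[OF x]) auto
  moreover have "indicator {0} (2 *\<^sub>R z) = (indicator {0} z :: ennreal)" for z :: 'a
    by (simp add: indicator_def)
  ultimately have "ennreal (2 ^ (DIM('a) - 1)) * ?e = ?e"
    by (simp add: sets_subspace_lborel)
  moreover obtain r where r: "?e = ennreal r" "0 \<le> r" using fin by (cases ?e) auto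
  ultimately have "2 ^ (DIM('a) - 1) * r = r" by (simp add: ennreal_mult'[symmetric])
  moreover have "(2::real) ^ (DIM('a) - 1) \<noteq> 1" 
  proof -
    have "0 < DIM('a) - 1" using n by linarith
    then have "(1::real) < 2 ^ (DIM('a) - 1)" by (intro one_less_power) simp_all
    then show ?thesis by linarith
  qed
  ultimately have "?e = 0" using r by simp
  then show ?thesis
    by (intro AE_I[where N = "{0}"]) (auto simp: sets_subspace_lborel)
qed

subsection \<open>Polar coordinates\<close>

text \<open>Fubini applied after inserting
  \<open>1 = (\<integral>\<^sup>+s. d * norm y ^ d / s ^ (d + 1) * indicator {norm y..} s \<partial>lborel)\<close>
  and rescaling \<open>y = s *\<^sub>R z\<close>; this avoids constructing the surface measure of the sphere.\<close>

lemma nn_integral_polar: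
  fixes M :: "'a::euclidean_space measure"
  assumes "sigma_finite_measure M" and sets_M [measurable_cong]: "sets M = sets borel"
    and scale: "\<And>s F. 0 < s \<Longrightarrow> F \<in> borel_measurable borel \<Longrightarrow>
      ennreal (s ^ d) * (\<integral>\<^sup>+z. F (s *\<^sub>R z) \<partial>M) = (\<integral>\<^sup>+z. F z \<partial>M)"
    and nz: "AE z in M. z \<noteq> 0" and d: "0 < d"
    and [measurable]: "G \<in> borel_measurable borel"
  shows "(\<integral>\<^sup>+z. G z \<partial>M) = (\<integral>\<^sup>+z. (\<integral>\<^sup>+r. ennreal (d * r ^ (d - 1)) * indicator {0<..} r
      * G (r *\<^sub>R sgn z) \<partial>lborel) * indicator (cball 0 1) z \<partial>M)"
proof -
  interpret M: sigma_finite_measure M by fact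
  interpret pair_sigma_finite M "lborel :: real measure" ..
  interpret S: pair_sigma_finite "lborel :: real measure" M ..
  have [measurable]: "cball (0 :: 'a) 1 \<in> sets borel" by simp
  define k where "k s y = (if norm y \<le> s \<and> 0 < s then ennreal (d * norm y ^ d / s ^ (d + 1)) else 0)"
    for s :: real and y :: 'a
  have [measurable]: "case_prod k \<in> borel_measurable (borel \<Otimes>\<^sub>M borel)"
    unfolding k_def by measurable
  have k1: "(\<integral>\<^sup>+s. k s y \<partial>lborel) = 1" if "y \<noteq> 0" for y
  proof -
    have pos: "norm y > 0" using that by simp
    have "(\<integral>\<^sup>+s. k s y \<partial>lborel) =
        (\<integral>\<^sup>+s. ennreal (d * norm y ^ d / s ^ (d + 1)) * indicator {norm y..} s \<partial>lborel)"
      using less_le_trans[OF pos] by (intro nn_integral_cong) (simp add: k_def indicator_def)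
    also have "\<dots> = ennreal (0 - (- (norm y ^ d / norm y ^ d)))"
    proof (rule nn_integral_FTC_atLeast[where F = "\<lambda>s. - (norm y ^ d / s ^ d)"])
      fix s assume "norm y \<le> s"
      then have s: "s > 0" using pos by linarith
      obtain m where m: "d = Suc m" using d by (cases d) auto
      have e: "s * s ^ (k - Suc 0) = s ^ k" if "0 < k" for k using that by (cases k) auto
      show "((\<lambda>s. - (norm y ^ d / s ^ d)) has_real_derivative d * norm y ^ d / s ^ (d + 1)) (at s)"
        using s by (auto intro!: derivative_eq_intros simp: m e field_simps)
      show "0 \<le> d * norm y ^ d / s ^ (d + 1)" using s by simp
    next
      have "((\<lambda>s. - (norm y ^ d * inverse (s ^ d))) \<longlongrightarrow> - (norm y ^ d * 0)) at_top"
        using d by (intro tendsto_intros tendsto_inverse_0_at_top filterlim_pow_at_top filterlim_ident)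
      then show "((\<lambda>s. - (norm y ^ d / s ^ d)) \<longlongrightarrow> 0) at_top" by (simp add: divide_inverse)
    qed measurable
    finally show ?thesis using pos by simp
  qed
  have "(\<integral>\<^sup>+z. G z \<partial>M) = (\<integral>\<^sup>+z. \<integral>\<^sup>+s. k s z * G z \<partial>lborel \<partial>M)"
    by (rule nn_integral_cong_AE, rule eventually_mono[OF nz]) (simp add: nn_integral_multc k1)
  also have "\<dots> = (\<integral>\<^sup>+s. \<integral>\<^sup>+z. k s z * G z \<partial>M \<partial>lborel)"
    by (rule S.Fubini') measurable
  also have "\<dots> = (\<integral>\<^sup>+s. \<integral>\<^sup>+z. ennreal (d * norm z ^ d * s ^ (d - 1)) * indicator {0<..} s * G (s *\<^sub>R z)
      * indicator (cball 0 1) z \<partial>M \<partial>lborel)"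
  proof (rule nn_integral_cong)
    fix s :: real
    show "(\<integral>\<^sup>+z. k s z * G z \<partial>M) = (\<integral>\<^sup>+z. ennreal (d * norm z ^ d * s ^ (d - 1)) * indicator {0<..} s
      * G (s *\<^sub>R z) * indicator (cball 0 1) z \<partial>M)"
    proof (cases "0 < s")
      case True
      \<comment> \<open>Under the rescaling, the condition \<open>norm y \<le> s\<close> in
        \<open>k\<close> becomes membership of \<open>z\<close> in the unit ball, a domain
        independent of \<open>s\<close>.\<close>
      have "ennreal (s ^ d) * (k s (s *\<^sub>R z) * G (s *\<^sub>R z)) = ennreal (d * norm z ^ d * s ^ (d - 1))
          * indicator {0<..} s * G (s *\<^sub>R z) * indicator (cball 0 1) z" for z :: 'a
      proof -
        have "s ^ d * (d * (s * norm z) ^ d / s ^ (d + 1)) = d * norm z ^ d * s ^ (d - 1)"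
          using True d by (cases d) (auto simp: field_simps)
        then show ?thesis using True
          by (auto simp: k_def indicator_def mult.assoc[symmetric] ennreal_mult'[symmetric])
      qed
      moreover have "(\<integral>\<^sup>+z. k s z * G z \<partial>M) = (\<integral>\<^sup>+z. ennreal (s ^ d) * (k s (s *\<^sub>R z) * G (s *\<^sub>R z)) \<partial>M)"
        using scale[OF True, of "\<lambda>z. k s z * G z"] by (simp add: nn_integral_cmult)
      ultimately show ?thesis by simp
    qed (simp add: k_def)
  qed
  also have "\<dots> = (\<integral>\<^sup>+z. \<integral>\<^sup>+s. ennreal (d * norm z ^ d * s ^ (d - 1)) * indicator {0<..} s * G (s *\<^sub>R z)
      * indicator (cball 0 1) z \<partial>lborel \<partial>M)"
    by (rule Fubini') measurable
  also have "\<dots> = (\<integral>\<^sup>+z. (\<integral>\<^sup>+r. ennreal (d * r ^ (d - 1)) * indicator {0<..} r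
      * G (r *\<^sub>R sgn z) \<partial>lborel) * indicator (cball 0 1) z \<partial>M)"
  proof (rule nn_integral_cong_AE, rule eventually_mono[OF nz])
    fix z :: 'a assume z: "z \<noteq> 0"
    \<comment> \<open>This is the substitution \<open>r = norm z * s\<close>, which trades
      \<open>s *\<^sub>R z\<close> for \<open>r *\<^sub>R sgn z\<close> and absorbs the factor
      \<open>norm z ^ d\<close>. The summand 0 matches the affine form of
      \<open>nn_integral_real_affine\<close>.\<close>
    have *: "ennreal (norm z) * (ennreal (d * (0 + norm z * s) ^ (d - 1)) * indicator {0<..} (0 + norm z * s)
        * G ((0 + norm z * s) *\<^sub>R sgn z))
        = ennreal (d * norm z ^ d * s ^ (d - 1)) * indicator {0<..} s * G (s *\<^sub>R z)" for s
    proof -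
      have "norm z * (d * (norm z * s) ^ (d - 1)) = d * norm z ^ d * s ^ (d - 1)"
        using d by (cases d) (auto simp: field_simps)
      then have "ennreal (norm z) * ennreal (d * (norm z * s) ^ (d - 1)) = ennreal (d * norm z ^ d * s ^ (d - 1))"
        by (simp only: ennreal_mult'[symmetric] norm_ge_zero)
      moreover have "(norm z * s) *\<^sub>R sgn z = s *\<^sub>R z" using z by (simp add: sgn_div_norm)
      ultimately show ?thesis using z
        by (simp add: indicator_def mult.assoc[symmetric] zero_less_mult_iff)
    qed
    let ?f = "\<lambda>r::real. ennreal (d * r ^ (d - 1)) * indicator {0<..} r * G (r *\<^sub>R sgn z)"
    have "(\<integral>\<^sup>+r. ?f r \<partial>lborel) = ennreal \<bar>norm z\<bar> * (\<integral>\<^sup>+s. ?f (0 + norm z * s) \<partial>lborel)"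
      by (rule nn_integral_real_affine) (use z in simp_all)
    also have "\<dots> = (\<integral>\<^sup>+s. ennreal (norm z) * ?f (0 + norm z * s) \<partial>lborel)"
      by (simp add: nn_integral_cmult del: add_0_left)
    also have "\<dots> = (\<integral>\<^sup>+s. ennreal (d * norm z ^ d * s ^ (d - 1)) * indicator {0<..} s * G (s *\<^sub>R z) \<partial>lborel)"
      by (simp only: *)
    finally have "(\<integral>\<^sup>+r. ?f r \<partial>lborel) =
        (\<integral>\<^sup>+s. ennreal (d * norm z ^ d * s ^ (d - 1)) * indicator {0<..} s * G (s *\<^sub>R z) \<partial>lborel)" .
    then show "(\<integral>\<^sup>+s. ennreal (d * norm z ^ d * s ^ (d - 1)) * indicator {0<..} s * G (s *\<^sub>R z)
      * indicator (cball 0 1) z \<partial>lborel) = (\<integral>\<^sup>+r. ennreal (d * r ^ (d - 1)) * indicator {0<..} r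
      * G (r *\<^sub>R sgn z) \<partial>lborel) * indicator (cball 0 1) z"
      by (simp add: nn_integral_multc)
  qed
  finally show ?thesis .
qed

lemma nn_integral_hyperplane_lborel_polar:
  fixes x :: "'a::euclidean_space"
  assumes x: "norm x = 1" and n: "DIM('a) \<ge> 2" and G: "G \<in> borel_measurable borel"
  shows "(\<integral>\<^sup>+z. G z \<partial>hyperplane_lborel x) =
    (\<integral>\<^sup>+z. (\<integral>\<^sup>+r. ennreal (real (DIM('a) - 1) * r ^ (DIM('a) - 1 - 1)) * indicator {0<..} r
      * G (r *\<^sub>R sgn z) \<partial>lborel) * indicator (cball 0 1) z \<partial>hyperplane_lborel x)"
  using nn_integral_polar[OF sigma_finite_hyperplane_lborel[OF x] sets_subspace_lborel
      nn_integral_hyperplane_lborel_scale[OF x] AE_hyperplane_lborel_nonzero[OF x n] _ G] n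
  by simp

section \<open>Section volume in polar coordinates\<close>

lemma radial_function_pos:
  assumes L: "starbody L" and x: "norm x = 1"
  shows "0 < radial_function L x"
proof -
  obtain e where e: "e > 0" "ball 0 e \<subseteq> L"
    using L unfolding starbody_def mem_interior by auto
  have "(e / 2) *\<^sub>R x \<in> L" using e x by (auto simp: subset_eq)
  then show ?thesis using starbody_mem_iff[OF L x, of "e / 2"] e by simp
qed

lemma borel_measurable_real_polynomial_function:
  fixes p :: "'a::euclidean_space \<Rightarrow> real"
  assumes "real_polynomial_function p"
  shows "p \<in> borel_measurable borel"
  using assms by (intro borel_measurable_continuous_onI continuous_at_imp_continuous_on ballI)
    (simp add: continuous_real_polymonial_function)

text \<open>Integrating a function of \<open>sgn z\<close> over the unit ball of the hyperplane
  gives \<open>1 / (n - 1)\<close> times its integral over the unit sphere there, where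
  \<open>n\<close> is \<open>DIM('a)\<close>; hence no separate factor appears. In polar
  coordinates, the ray through \<open>sgn z\<close> meets \<open>L\<close> up to radius
  \<open>p (sgn z)\<close>, and the weight \<open>d * r ^ (d - 1)\<close> integrates to
  \<open>p (sgn z) ^ d\<close>.\<close>

lemma section_volume_eq_integral:
  fixes x :: "'a::euclidean_space"
  assumes L: "starbody L" and p: "real_polynomial_function p"
    and rad: "\<And>y. norm y = 1 \<Longrightarrow> radial_function L y = p y"
    and x: "norm x = 1" and n: "DIM('a) \<ge> 2"
  shows "section_volume L x =
    (\<integral>z. p (sgn z) ^ (DIM('a) - 1) * indicator (cball 0 1) z \<partial>hyperplane_lborel x)"
proof -
  define d where "d = DIM('a) - 1"
  have d: "0 < d" using n by (simp add: d_def)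
  note [measurable] = borel_measurable_real_polynomial_function[OF p]
  have [measurable]: "L \<in> sets borel"
    using L by (auto simp: starbody_def intro: borel_closed compact_imp_closed)
  have [measurable]: "cball (0 :: 'a) 1 \<in> sets borel" by simp
  have [measurable]: "{y. x \<bullet> y = 0} \<in> sets borel" by (intro borel_closed closed_hyperplane)
  have inner: "(\<integral>\<^sup>+r. ennreal (d * r ^ (d - 1)) * indicator {0<..} r * indicator L (r *\<^sub>R sgn z) \<partial>lborel)
      = ennreal (p (sgn z) ^ d)" if "z \<noteq> 0" for z
  proof -
    have sz: "norm (sgn z) = 1" using that by (simp add: norm_sgn)
    have nonneg: "0 \<le> p (sgn z)" using radial_function_pos[OF L sz] rad[OF sz] by simp
    have "(\<integral>\<^sup>+r. ennreal (d * r ^ (d - 1)) * indicator {0<..} r * indicator L (r *\<^sub>R sgn z) \<partial>lborel) =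
        (\<integral>\<^sup>+r. ennreal (d * r ^ (d - 1)) * indicator {0..p (sgn z)} r \<partial>lborel)"
    \<comment> \<open>The two integrands may differ at \<open>r = 0\<close>, which is a null set;
      \<open>starbody_mem_iff\<close> covers positive radii.\<close>
    proof (rule nn_integral_cong_AE, rule eventually_mono[OF AE_lborel_singleton[of 0]])
      fix r :: real assume "r \<noteq> 0"
      then show "ennreal (d * r ^ (d - 1)) * indicator {0<..} r * indicator L (r *\<^sub>R sgn z) =
          ennreal (d * r ^ (d - 1)) * indicator {0..p (sgn z)} r"
        using starbody_mem_iff[OF L sz, of r] rad[OF sz] by (auto simp: indicator_def)
    qed
    also have "\<dots> = ennreal (p (sgn z) ^ d - 0 ^ d)"
      by (rule nn_integral_FTC_Icc) (use nonneg in \<open>auto intro!: derivative_eq_intros\<close>)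
    finally show ?thesis by (simp add: zero_power[OF d])
  qed
  have "emeasure (hyperplane_lborel x) (L \<inter> {y. x \<bullet> y = 0}) = emeasure (hyperplane_lborel x) L"
    by (rule emeasure_eq_AE[OF eventually_mono[OF AE_hyperplane_lborel[of x]]]) auto
  also have "\<dots> = (\<integral>\<^sup>+z. indicator L z \<partial>hyperplane_lborel x)" by simp
  also have "\<dots> = (\<integral>\<^sup>+z. (\<integral>\<^sup>+r. ennreal (d * r ^ (d - 1)) * indicator {0<..} r
      * indicator L (r *\<^sub>R sgn z) \<partial>lborel) * indicator (cball 0 1) z \<partial>hyperplane_lborel x)"
    unfolding d_def by (rule nn_integral_hyperplane_lborel_polar[OF x n]) measurable
  also have "\<dots> = (\<integral>\<^sup>+z. ennreal (p (sgn z) ^ d * indicator (cball 0 1) z) \<partial>hyperplane_lborel x)"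
    by (rule nn_integral_cong_AE, rule eventually_mono[OF AE_hyperplane_lborel_nonzero[OF x n]],
        subst inner) (simp_all split: split_indicator)
  finally have "section_volume L x =
      enn2real (\<integral>\<^sup>+z. ennreal (p (sgn z) ^ d * indicator (cball 0 1) z) \<partial>hyperplane_lborel x)"
    by (simp add: section_volume_def measure_def)
  also have "\<dots> = (\<integral>z. p (sgn z) ^ d * indicator (cball 0 1) z \<partial>hyperplane_lborel x)"
  proof (rule integral_eq_nn_integral[symmetric])
    show "AE z in hyperplane_lborel x. 0 \<le> p (sgn z) ^ d * indicator (cball 0 1) z"
    proof (rule eventually_mono[OF AE_hyperplane_lborel_nonzero[OF x n]])
      fix z :: 'a assume "z \<noteq> 0"
      then have "norm (sgn z) = 1" by (simp add: norm_sgn)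
      then show "0 \<le> p (sgn z) ^ d * indicator (cball 0 1) z"
        using radial_function_pos[OF L, of "sgn z"] rad[of "sgn z"] by simp
    qed
  qed (simp add: sgn_div_norm)
  finally show ?thesis by (simp add: d_def)
qed

section \<open>Homogeneous integrands on the unit balls of the space and of the hyperplane\<close>

text \<open>The radial factor produced by a homogeneous function of degree \<open>k\<close> when the
  hyperplane has dimension \<open>d\<close>; the inner integral is the length of a chord of the unit
  disc. For \<open>d > 0\<close> it is the Beta value \<open>d * B((d + k) / 2, 3 / 2)\<close>, but
  only its positivity and finiteness matter, since the constant is later divided out.\<close>

definition radial_moment :: "nat \<Rightarrow> nat \<Rightarrow> ennreal" where
  "radial_moment d k = (\<integral>\<^sup>+r. ennreal (d * r ^ (d - 1)) * indicator {0<..} r * (ennreal (r ^ k)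
    * (\<integral>\<^sup>+t. (if r\<^sup>2 + t\<^sup>2 \<le> 1 then 1 else 0) \<partial>lborel)) \<partial>lborel)"

text \<open>The integrand vanishes outside \<open>0 < r \<le> 1\<close>, and there the chord has
  length at most 2 and the powers of \<open>r\<close> are at most 1.\<close>

lemma radial_moment_finite: "radial_moment d k < \<infinity>"
proof -
  have "radial_moment d k \<le> (\<integral>\<^sup>+r. ennreal (2 * d) * indicator {0..1::real} r \<partial>lborel)"
    unfolding radial_moment_def
  proof (rule nn_integral_mono)
    fix r :: real
    show "ennreal (d * r ^ (d - 1)) * indicator {0<..} r * (ennreal (r ^ k)
      * (\<integral>\<^sup>+t. (if r\<^sup>2 + t\<^sup>2 \<le> 1 then 1 else 0) \<partial>lborel)) \<le> ennreal (2 * d) * indicator {0..1} r"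
    proof (cases "0 < r \<and> r \<le> 1")
      case True
      have "(\<integral>\<^sup>+t. (if r\<^sup>2 + t\<^sup>2 \<le> 1 then 1 else 0) \<partial>lborel) \<le>
          (\<integral>\<^sup>+t. indicator {-1..1::real} t \<partial>lborel)"
      proof (rule nn_integral_mono)
        fix t :: real
        have "\<bar>t\<bar> \<le> 1" if "r\<^sup>2 + t\<^sup>2 \<le> 1"
          using that zero_le_power2[of r] by (intro abs_le_square_iff[THEN iffD2, of t 1, simplified]) linarith
        then show "(if r\<^sup>2 + t\<^sup>2 \<le> 1 then 1 else 0) \<le> (indicator {-1..1} t :: ennreal)"
          by (auto simp: indicator_def)
      qed
      then have "(\<integral>\<^sup>+t. (if r\<^sup>2 + t\<^sup>2 \<le> 1 then 1 else 0) \<partial>lborel) \<le> ennreal 2" by simp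
      then have "ennreal (d * r ^ (d - 1)) * (ennreal (r ^ k) * (\<integral>\<^sup>+t. (if r\<^sup>2 + t\<^sup>2 \<le> 1 then 1 else 0) \<partial>lborel))
          \<le> ennreal d * (ennreal 1 * ennreal 2)"
        using True by (intro mult_mono ennreal_leI) (auto simp: power_le_one mult_left_le)
      moreover have "ennreal d * (ennreal 1 * ennreal 2) = ennreal (2 * d)"
        by (simp add: ennreal_mult' mult.commute)
      ultimately show ?thesis using True by simp
    next
      case False
      then have "r \<le> 0 \<or> 1 < r\<^sup>2" using one_less_power[of r 2] by auto
      then have "r \<le> 0 \<or> (\<forall>t. \<not> r\<^sup>2 + t\<^sup>2 \<le> 1)"
        using zero_le_power2 by (smt (verit))
      then show ?thesis by auto
    qed
  qed
  also have "\<dots> < \<infinity>" by (simp add: nn_integral_cmult)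
  finally show ?thesis .
qed

text \<open>The rectangle with \<open>r\<close> in \<open>{1/4..1/2}\<close> and \<open>t\<close> in
  \<open>{-1/2..1/2}\<close> lies in the unit disc. On it the powers of \<open>r\<close> are bounded
  below by their values at \<open>1/4\<close>, and the chord has length at least 1.\<close>

lemma radial_moment_pos:
  assumes "0 < d"
  shows "0 < radial_moment d k"
proof -
  let ?c = "d * (1/4) ^ (d - 1) * (1/4) ^ k :: real"
  have "0 < ennreal ?c * ennreal (1/4)" using assms by (simp add: ennreal_zero_less_mult_iff)
  also have "\<dots> = (\<integral>\<^sup>+r. ennreal ?c * indicator {1/4..1/2::real} r \<partial>lborel)"
    by (simp add: nn_integral_cmult)
  also have "\<dots> \<le> radial_moment d k" unfolding radial_moment_def
  proof (rule nn_integral_mono)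
    fix r :: real
    show "ennreal ?c * indicator {1/4..1/2} r \<le> ennreal (d * r ^ (d - 1)) * indicator {0<..} r
      * (ennreal (r ^ k) * (\<integral>\<^sup>+t. (if r\<^sup>2 + t\<^sup>2 \<le> 1 then 1 else 0) \<partial>lborel))"
    proof (cases "r \<in> {1/4..1/2}")
      case True
      have "(\<integral>\<^sup>+t. indicator {-1/2..1/2::real} t \<partial>lborel) \<le>
          (\<integral>\<^sup>+t. (if r\<^sup>2 + t\<^sup>2 \<le> 1 then 1 else 0) \<partial>lborel)"
      proof (rule nn_integral_mono)
        fix t :: real
        have "r\<^sup>2 + t\<^sup>2 \<le> 1" if "t \<in> {-1/2..1/2}"
          using that True abs_le_square_iff[of t "1/2"] abs_le_square_iff[of r "1/2"]
          by (auto simp: power2_eq_square abs_le_iff)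
        then show "indicator {-1/2..1/2} t \<le> (if r\<^sup>2 + t\<^sup>2 \<le> 1 then 1 else 0 :: ennreal)"
          by (auto simp: indicator_def)
      qed
      then have "1 \<le> (\<integral>\<^sup>+t. (if r\<^sup>2 + t\<^sup>2 \<le> 1 then 1 else 0) \<partial>lborel)" by simp
      then have "ennreal (d * (1/4) ^ (d - 1)) * (ennreal ((1/4) ^ k) * 1) \<le> ennreal (d * r ^ (d - 1))
          * (ennreal (r ^ k) * (\<integral>\<^sup>+t. (if r\<^sup>2 + t\<^sup>2 \<le> 1 then 1 else 0) \<partial>lborel))"
        using True by (intro mult_mono ennreal_leI mult_left_mono power_mono) auto
      then show ?thesis using True by (simp add: ennreal_mult'[symmetric])
    qed simp
  qed
  finally show ?thesis .
qed

text \<open>For \<open>y = z + t *\<^sub>R x\<close> with \<open>z\<close> orthogonal to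
  \<open>x\<close>, Pythagoras turns membership in the unit ball into a condition on
  \<open>norm z\<close> and \<open>t\<close> alone. Polar coordinates for \<open>z\<close> and
  homogeneity then separate the radial factor from \<open>h (sgn z)\<close>. As
  \<open>ennreal\<close> truncates negative values, this treats the positive part of
  \<open>h\<close>.\<close>

lemma nn_integral_cball_homogeneous:
  fixes x :: "'a::euclidean_space"
  assumes x: "norm x = 1" and n: "DIM('a) \<ge> 2" and [measurable]: "h \<in> borel_measurable borel"
    and hom: "\<And>s y. 0 < s \<Longrightarrow> h (s *\<^sub>R y) = s ^ k * h y"
  shows "(\<integral>\<^sup>+y. ennreal (h (y - (x \<bullet> y) *\<^sub>R x) * indicator (cball 0 1) y) \<partial>lborel) =
    radial_moment (DIM('a) - 1) k *
    (\<integral>\<^sup>+z. ennreal (h (sgn z) * indicator (cball 0 1) z) \<partial>hyperplane_lborel x)"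
proof -
  define d where "d = DIM('a) - 1"
  have [measurable]: "cball (0 :: 'a) 1 \<in> sets borel" by simp
  let ?w = "\<lambda>r t. if r\<^sup>2 + t\<^sup>2 \<le> 1 then 1 else 0 :: ennreal"
  let ?U = "\<lambda>r::real. \<integral>\<^sup>+t. ?w r t \<partial>lborel"
  have "ennreal (h (y - (x \<bullet> y) *\<^sub>R x) * indicator (cball 0 1) y) =
      ennreal (h (y - (x \<bullet> y) *\<^sub>R x)) * ?w (norm (y - (x \<bullet> y) *\<^sub>R x)) (x \<bullet> y)" for y
  proof -
    have "(norm (y - (x \<bullet> y) *\<^sub>R x))\<^sup>2 + (x \<bullet> y)\<^sup>2 = (norm y)\<^sup>2"
      unfolding power2_norm_eq_inner using norm_eq_1[of x] x
      by (simp add: inner_diff_left inner_diff_right inner_commute power2_eq_square)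
    moreover have "norm y \<le> 1 \<longleftrightarrow> (norm y)\<^sup>2 \<le> 1" using abs_le_square_iff[of "norm y" 1] by simp
    ultimately show ?thesis by (simp add: indicator_def)
  qed
  then have "(\<integral>\<^sup>+y. ennreal (h (y - (x \<bullet> y) *\<^sub>R x) * indicator (cball 0 1) y) \<partial>lborel) =
      (\<integral>\<^sup>+z. \<integral>\<^sup>+t. ennreal (h z) * ?w (norm z) t \<partial>lborel \<partial>hyperplane_lborel x)"
    using nn_integral_lborel_hyperplane_proj[OF x, of "\<lambda>z t. ennreal (h z) * ?w (norm z) t"] by simp
  also have "\<dots> = (\<integral>\<^sup>+z. ennreal (h z) * ?U (norm z) \<partial>hyperplane_lborel x)"
    by (simp add: nn_integral_cmult)
  also have "\<dots> = (\<integral>\<^sup>+z. (\<integral>\<^sup>+r. ennreal (d * r ^ (d - 1)) * indicator {0<..} r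
      * (ennreal (h (r *\<^sub>R sgn z)) * ?U (norm (r *\<^sub>R sgn z))) \<partial>lborel) * indicator (cball 0 1) z
      \<partial>hyperplane_lborel x)"
    unfolding d_def by (rule nn_integral_hyperplane_lborel_polar[OF x n]) measurable
  also have "\<dots> = (\<integral>\<^sup>+z. radial_moment d k * ennreal (h (sgn z) * indicator (cball 0 1) z) \<partial>hyperplane_lborel x)"
  proof (rule nn_integral_cong_AE, rule eventually_mono[OF AE_hyperplane_lborel_nonzero[OF x n]])
    fix z :: 'a assume z: "z \<noteq> 0"
    have "ennreal (d * r ^ (d - 1)) * indicator {0<..} r * (ennreal (h (r *\<^sub>R sgn z)) * ?U (norm (r *\<^sub>R sgn z)))
        = ennreal (d * r ^ (d - 1)) * indicator {0<..} r * (ennreal (r ^ k) * ?U r) * ennreal (h (sgn z))" for r :: real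
      using z by (cases "0 < r") (simp_all add: hom norm_sgn ennreal_mult' mult_ac)
    then have "(\<integral>\<^sup>+r. ennreal (d * r ^ (d - 1)) * indicator {0<..} r
        * (ennreal (h (r *\<^sub>R sgn z)) * ?U (norm (r *\<^sub>R sgn z))) \<partial>lborel) = radial_moment d k * ennreal (h (sgn z))"
      by (simp add: radial_moment_def nn_integral_multc)
    then show "(\<integral>\<^sup>+r. ennreal (d * r ^ (d - 1)) * indicator {0<..} r
        * (ennreal (h (r *\<^sub>R sgn z)) * ?U (norm (r *\<^sub>R sgn z))) \<partial>lborel) * indicator (cball 0 1) z
        = radial_moment d k * ennreal (h (sgn z) * indicator (cball 0 1) z)"
      by (simp add: indicator_def)
  qed
  also have "\<dots> = radial_moment d k *
      (\<integral>\<^sup>+z. ennreal (h (sgn z) * indicator (cball 0 1) z) \<partial>hyperplane_lborel x)"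
    by (rule nn_integral_cmult) (simp add: sgn_div_norm)
  finally show ?thesis by (simp add: d_def)
qed

lemma integrable_sgn_cball:
  fixes x :: "'a::euclidean_space"
  assumes x: "norm x = 1" and q: "real_polynomial_function q"
  shows "integrable (hyperplane_lborel x) (\<lambda>z. q (sgn z) * indicator (cball 0 1) z)"
proof -
  note [measurable] = borel_measurable_real_polynomial_function[OF q]
  have [measurable]: "cball (0 :: 'a) 1 \<in> sets borel" by simp
  \<comment> \<open>The bound is taken on the ball rather than on the sphere because
    \<open>sgn 0 = 0\<close>.\<close>
  have "continuous_on (cball 0 1) q"
    by (intro continuous_at_imp_continuous_on ballI continuous_real_polymonial_function[OF q])
  then have "bounded (q ` cball 0 1)"
    by (intro compact_imp_bounded compact_continuous_image) auto
  then obtain C where C: "\<And>y. norm y \<le> 1 \<Longrightarrow> \<bar>q y\<bar> \<le> C" by (metis bounded_iff imageI mem_cball_0 real_norm_def)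
  show ?thesis
  proof (rule integrableI_bounded_set[where A = "cball 0 1" and B = C])
    show "AE z in hyperplane_lborel x. z \<in> cball 0 1 \<longrightarrow> norm (q (sgn z) * indicator (cball 0 1) z) \<le> C"
      using C by (auto simp: norm_sgn abs_mult)
  qed (use emeasure_hyperplane_lborel_cball[OF x] in \<open>auto simp: sgn_div_norm\<close>)
qed

lemma integrable_lborel_cball:
  fixes q :: "'a::euclidean_space \<Rightarrow> real"
  assumes "continuous_on UNIV q"
  shows "integrable lborel (\<lambda>y. q y * indicator (cball 0 1) y)"
  using borel_integrable_compact[OF compact_cball continuous_on_subset[OF assms subset_UNIV], of 0 1]
  by (simp add: mult.commute)

lemma integral_cball_homogeneous:
  fixes x :: "'a::euclidean_space"
  assumes x: "norm x = 1" and n: "DIM('a) \<ge> 2" and h: "real_polynomial_function h"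
    and hom: "\<And>s y. 0 < s \<Longrightarrow> h (s *\<^sub>R y) = s ^ k * h y"
  shows "(\<integral>y. h (y - (x \<bullet> y) *\<^sub>R x) * indicator (cball 0 1) y \<partial>lborel) =
    enn2real (radial_moment (DIM('a) - 1) k) *
    (\<integral>z. h (sgn z) * indicator (cball 0 1) z \<partial>hyperplane_lborel x)"
proof -
  note m = borel_measurable_real_polynomial_function[OF h]
  have "continuous_on UNIV h"
    by (intro continuous_at_imp_continuous_on ballI continuous_real_polymonial_function[OF h])
  then have "continuous_on UNIV (\<lambda>y. h (y - (x \<bullet> y) *\<^sub>R x))"
    by (rule continuous_on_compose2) (auto intro!: continuous_intros)
  note int = integrable_lborel_cball[OF this]
  \<comment> \<open>The negative part is handled by the same identity for \<open>- h\<close>, which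
    is homogeneous of the same degree.\<close>
  have "(\<integral>\<^sup>+y. ennreal (- (h (y - (x \<bullet> y) *\<^sub>R x) * indicator (cball 0 1) y)) \<partial>lborel) =
    radial_moment (DIM('a) - 1) k *
    (\<integral>\<^sup>+z. ennreal (- (h (sgn z) * indicator (cball 0 1) z)) \<partial>hyperplane_lborel x)"
    using nn_integral_cball_homogeneous[OF x n, of "\<lambda>y. - h y" k] m hom by simp
  then show ?thesis
    unfolding real_lebesgue_integral_def[OF int] real_lebesgue_integral_def[OF integrable_sgn_cball[OF x h]]
    by (simp add: nn_integral_cball_homogeneous[OF x n m hom] enn2real_mult right_diff_distrib)
qed

subsection \<open>Polynomials\<close>

text \<open>The decomposition into homogeneous parts is kept as a closure property, without
  coefficients or a list of degrees; several summands may share a degree. This suffices for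
  statements that are additive in the polynomial.\<close>

inductive sum_homogeneous :: "('a::euclidean_space \<Rightarrow> real) \<Rightarrow> bool" where
  homogeneous: "real_polynomial_function h \<Longrightarrow> (\<And>s y. 0 < s \<Longrightarrow> h (s *\<^sub>R y) = s ^ k * h y) \<Longrightarrow>
    sum_homogeneous h"
| add: "sum_homogeneous f \<Longrightarrow> sum_homogeneous g \<Longrightarrow> sum_homogeneous (\<lambda>y. f y + g y)"

lemma sum_homogeneous_mult:
  assumes "sum_homogeneous f" "sum_homogeneous g"
  shows "sum_homogeneous (\<lambda>y. f y * g y)"
  using assms(1)
proof induction
  case f: (homogeneous f k)
  show ?case using assms(2)
  proof induction
    case g: (homogeneous g l)
    show ?case
      by (rule sum_homogeneous.homogeneous[of _ "k + l"])
         (use f g in \<open>auto simp: power_add\<close>)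
  next
    case (add g g')
    then show ?case using sum_homogeneous.add[OF add.IH] by (simp add: distrib_left)
  qed
next
  case (add f f')
  then show ?case using sum_homogeneous.add[OF add.IH] by (simp add: distrib_right)
qed

lemma real_polynomial_function_sum_homogeneous:
  assumes "real_polynomial_function p"
  shows "sum_homogeneous p"
  using assms
proof induction
  case (linear f)
  then show ?case
    by (intro sum_homogeneous.homogeneous[of _ 1]) (auto simp: linear_simps)
next
  case (const c)
  then show ?case by (intro sum_homogeneous.homogeneous[of _ 0]) auto
qed (auto intro: sum_homogeneous.add sum_homogeneous_mult)

text \<open>Polynomials in two vector variables, written as finite sums of products with the
  variables separated, so that integrating out \<open>y\<close> visibly leaves a polynomial in
  \<open>x\<close>.\<close>

inductive separable_polynomial :: "('a::euclidean_space \<Rightarrow> 'b::euclidean_space \<Rightarrow> real) \<Rightarrow> bool" where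
  prod: "real_polynomial_function a \<Longrightarrow> real_polynomial_function b \<Longrightarrow>
    separable_polynomial (\<lambda>x y. a x * b y)"
| add: "separable_polynomial f \<Longrightarrow> separable_polynomial g \<Longrightarrow> separable_polynomial (\<lambda>x y. f x y + g x y)"

lemma separable_polynomial_mult:
  assumes "separable_polynomial f" "separable_polynomial g"
  shows "separable_polynomial (\<lambda>x y. f x y * g x y)"
  using assms(1)
proof induction
  case f: (prod a b)
  show ?case using assms(2)
  proof induction
    case g: (prod a' b')
    have "separable_polynomial (\<lambda>x y. (a x * a' x) * (b y * b' y))"
      using f g by (intro separable_polynomial.prod) auto
    then show ?case by (simp add: mult_ac)
  next
    case (add g g')
    then show ?case using separable_polynomial.add[OF add.IH] by (simp add: distrib_left)
  qed
next
  case (add f f')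
  then show ?case using separable_polynomial.add[OF add.IH] by (simp add: distrib_right)
qed

lemma separable_polynomial_sum:
  assumes "\<And>i. i \<in> I \<Longrightarrow> separable_polynomial (f i)"
  shows "separable_polynomial (\<lambda>x y. \<Sum>i\<in>I. f i x y)"
proof -
  have "separable_polynomial (\<lambda>x y. 0)"
    using separable_polynomial.prod[of "\<lambda>_. 0" "\<lambda>_. 0"] by auto
  then show ?thesis using assms
    by (induction I rule: infinite_finite_induct) (auto intro: separable_polynomial.add)
qed

text \<open>For linear \<open>h\<close> the value is \<open>h y - (x \<bullet> y) * h x\<close>, and
  expanding the inner product over \<open>Basis\<close> separates the variables. Sums and products
  preserve separability.\<close>

lemma separable_polynomial_proj:
  fixes h :: "'a::euclidean_space \<Rightarrow> real"
  assumes "real_polynomial_function h"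
  shows "separable_polynomial (\<lambda>x y. h (y - (x \<bullet> y) *\<^sub>R x))"
  using assms
proof induction
  case (linear h)
  have "separable_polynomial (\<lambda>x y. 1 * h y + (\<Sum>i\<in>Basis. (- (x \<bullet> i) * h x) * (y \<bullet> i)))"
  proof (intro separable_polynomial.add separable_polynomial.prod separable_polynomial_sum)
    show i: "real_polynomial_function (\<lambda>x. x \<bullet> i)" for i
      by (intro real_polynomial_function.intros(1) bounded_linear_inner_left)
    show "real_polynomial_function (\<lambda>x. - (x \<bullet> i) * h x)" for i
      using real_polynomial_function.intros(1)[OF linear]
      by (intro real_polynomial_function.intros(4) real_polynomial_function_minus i)
  qed (use linear in auto)
  moreover have "h (y - (x \<bullet> y) *\<^sub>R x) = 1 * h y + (\<Sum>i\<in>Basis. (- (x \<bullet> i) * h x) * (y \<bullet> i))" for x y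
    using linear by (simp add: linear_simps euclidean_inner[of x y] sum_distrib_left sum_distrib_right sum_negf mult_ac)
  ultimately show ?case by simp
next
  case (const c)
  then show ?case using separable_polynomial.prod[of "\<lambda>_. c" "\<lambda>_. 1"] by auto
qed (auto intro: separable_polynomial.add separable_polynomial_mult)

text \<open>The domain of integration does not depend on \<open>x\<close>, so \<open>a x\<close>
  comes out of the integral and the integral of \<open>b\<close> is a constant. Integrability is
  part of the claim so that integrals can be added in the induction.\<close>

lemma separable_polynomial_integral:
  assumes "separable_polynomial f"
  shows "\<exists>Q. real_polynomial_function Q \<and>
    (\<forall>x. integrable lborel (\<lambda>y. f x y * indicator (cball 0 1) y) \<and>
      (\<integral>y. f x y * indicator (cball 0 1) y \<partial>lborel) = Q x)"
  using assms
proof induction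
  case (prod a b)
  have "continuous_on UNIV b"
    using prod by (intro continuous_at_imp_continuous_on ballI continuous_real_polymonial_function)
  note int = integrable_lborel_cball[OF this]
  show ?case
    using prod int
    by (intro exI[of _ "\<lambda>x. a x * (\<integral>y. b y * indicator (cball 0 1) y \<partial>lborel)"])
       (auto simp: mult.assoc)
next
  case (add f g)
  obtain P where "real_polynomial_function P"
    "\<And>x. integrable lborel (\<lambda>y. f x y * indicator (cball 0 1) y)"
    "\<And>x. (\<integral>y. f x y * indicator (cball 0 1) y \<partial>lborel) = P x"
    using add.IH(1) by auto
  moreover obtain Q where "real_polynomial_function Q"
    "\<And>x. integrable lborel (\<lambda>y. g x y * indicator (cball 0 1) y)"
    "\<And>x. (\<integral>y. g x y * indicator (cball 0 1) y \<partial>lborel) = Q x"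
    using add.IH(2) by auto
  ultimately show ?case by (intro exI[of _ "\<lambda>x. P x + Q x"]) (auto simp: distrib_right)
qed

text \<open>For a homogeneous part, the integral over the fixed ball of the whole space is a
  polynomial in \<open>x\<close>, and it is divided by the positive constant \<open>c\<close>. That
  constant depends on the degree, which is why the parts are treated separately.\<close>

lemma sum_homogeneous_integral:
  fixes q :: "'a::euclidean_space \<Rightarrow> real"
  assumes "sum_homogeneous q" and n: "DIM('a) \<ge> 2"
  shows "\<exists>Q. real_polynomial_function Q \<and> (\<forall>x. norm x = 1 \<longrightarrow>
    integrable (hyperplane_lborel x) (\<lambda>z. q (sgn z) * indicator (cball 0 1) z) \<and>
    (\<integral>z. q (sgn z) * indicator (cball 0 1) z \<partial>hyperplane_lborel x) = Q x)"
  using assms(1)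
proof induction
  case (homogeneous h k)
  define c where "c = enn2real (radial_moment (DIM('a) - 1) k)"
  have c: "c > 0" unfolding c_def
    using n by (simp add: enn2real_positive_iff radial_moment_pos radial_moment_finite[simplified])
  obtain Q where Q: "real_polynomial_function Q"
    "\<And>x. (\<integral>y. h (y - (x \<bullet> y) *\<^sub>R x) * indicator (cball 0 1) y \<partial>lborel) = Q x"
    using separable_polynomial_integral[OF separable_polynomial_proj[OF homogeneous(1)]] by auto
  have "(\<integral>z. h (sgn z) * indicator (cball 0 1) z \<partial>hyperplane_lborel x) = Q x / c" if "norm x = 1" for x
    using integral_cball_homogeneous[OF that n homogeneous] c Q(2)[of x] by (simp add: c_def field_simps)
  then show ?case
    using Q(1) integrable_sgn_cball[OF _ homogeneous(1)]
    by (intro exI[of _ "\<lambda>x. Q x / c"]) auto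
next
  case (add f g)
  obtain P where "real_polynomial_function P"
    "\<And>x. norm x = 1 \<Longrightarrow> integrable (hyperplane_lborel x) (\<lambda>z. f (sgn z) * indicator (cball 0 1) z)"
    "\<And>x. norm x = 1 \<Longrightarrow> (\<integral>z. f (sgn z) * indicator (cball 0 1) z \<partial>hyperplane_lborel x) = P x"
    using add.IH(1) by auto
  moreover obtain Q where "real_polynomial_function Q"
    "\<And>x. norm x = 1 \<Longrightarrow> integrable (hyperplane_lborel x) (\<lambda>z. g (sgn z) * indicator (cball 0 1) z)"
    "\<And>x. norm x = 1 \<Longrightarrow> (\<integral>z. g (sgn z) * indicator (cball 0 1) z \<partial>hyperplane_lborel x) = Q x"
    using add.IH(2) by auto
  ultimately show ?case by (intro exI[of _ "\<lambda>x. P x + Q x"]) (auto simp: distrib_right)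
qed

lemma section_volume_polynomial:
  fixes L :: "'a::euclidean_space set"
  assumes L: "polyradial L" and n: "DIM('a) \<ge> 2"
  obtains Q where "real_polynomial_function Q" "\<And>x. norm x = 1 \<Longrightarrow> section_volume L x = Q x"
proof -
  obtain p where sL: "starbody L" and p: "real_polynomial_function p"
    and rad: "\<And>y. norm y = 1 \<Longrightarrow> radial_function L y = p y"
    using L by (auto simp: polyradial_def)
  have "sum_homogeneous (\<lambda>y. p y ^ (DIM('a) - 1))"
    using p by (intro real_polynomial_function_sum_homogeneous) auto
  from sum_homogeneous_integral[OF this n] obtain Q where "real_polynomial_function Q"
    "\<And>x. norm x = 1 \<Longrightarrow> (\<integral>z. p (sgn z) ^ (DIM('a) - 1) * indicator (cball 0 1) z \<partial>hyperplane_lborel x) = Q x"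
    by auto
  then show thesis using section_volume_eq_integral[OF sL p rad _ n] by (intro that[of Q]) auto
qed

subsection \<open>Intersection bodies\<close>

text \<open>Continuity of the section volume gives both nontrivial properties: compactness, as the
  body is a continuous image of \<open>{0..1} \<times> sphere 0 1\<close>, and an interior origin,
  as the positive minimum over the sphere is the radius of a ball inside the body.\<close>

lemma starbody_intersection_body:
  fixes L :: "'a::euclidean_space set"
  assumes L: "starbody L" and cont: "continuous_on (sphere 0 1) (section_volume L)"
  shows "starbody (intersection_body L)"
proof -
  let ?f = "\<lambda>(t, x). (t * section_volume L x) *\<^sub>R x"
  have eq: "intersection_body L = ?f ` ({0..1} \<times> sphere 0 1)"
  proof (intro equalityI subsetI)
    fix y assume "y \<in> intersection_body L"
    then obtain r x where "y = r *\<^sub>R x" "norm x = 1" "0 \<le> r" "r \<le> section_volume L x"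
      by (auto simp: intersection_body_def)
    then show "y \<in> ?f ` ({0..1} \<times> sphere 0 1)"
      using section_volume_pos[OF L, of x]
      \<comment> \<open>The quotient is the fraction of the full radius in the direction
        \<open>x\<close>; it is defined because section volumes are positive.\<close>
      by (intro image_eqI[of _ _ "(r / section_volume L x, x)"]) auto
  next
    fix y assume "y \<in> ?f ` ({0..1} \<times> sphere 0 1)"
    then obtain t x where "y = (t * section_volume L x) *\<^sub>R x" "norm x = 1" "0 \<le> t" "t \<le> 1"
      by auto
    then show "y \<in> intersection_body L"
      using section_volume_pos[OF L, of x]
      by (auto simp: intersection_body_def mult_le_cancel_right1
          intro!: exI[of _ "t * section_volume L x"] exI[of _ x])
  qed
  have "continuous_on ({0..1} \<times> sphere 0 1) (\<lambda>z. section_volume L (snd z))"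
    by (rule continuous_on_compose2[OF cont continuous_on_snd]) auto
  then have "continuous_on ({0..1} \<times> sphere 0 1) ?f"
    unfolding split_def by (intro continuous_intros)
  then have "compact (intersection_body L)"
    unfolding eq by (intro compact_continuous_image compact_Times) auto
  moreover have "closed_segment 0 y \<subseteq> intersection_body L" if y: "y \<in> intersection_body L" for y
  proof
    fix z assume "z \<in> closed_segment 0 y"
    then obtain u where u: "z = u *\<^sub>R y" "0 \<le> u" "u \<le> 1" by (auto simp: in_segment)
    obtain r x where r: "y = r *\<^sub>R x" "norm x = 1" "0 \<le> r" "r \<le> section_volume L x"
      using y by (auto simp: intersection_body_def)
    have "u * r \<le> section_volume L x" using u r mult_left_le_one_le[of r u] by linarith
    then show "z \<in> intersection_body L"
      using u r by (auto simp: intersection_body_def intro!: exI[of _ "u * r"] exI[of _ x])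
  qed
  moreover have "0 \<in> interior (intersection_body L)"
  proof -
    obtain b :: 'a where b: "norm b = 1" using vector_choose_size[of 1] by auto
    then have "sphere (0 :: 'a) 1 \<noteq> {}" by auto
    then obtain x0 where "\<forall>x\<in>sphere 0 1. section_volume L x0 \<le> section_volume L x"
      using continuous_attains_inf[OF compact_sphere _ cont] by blast
    then have x0: "section_volume L x0 \<le> section_volume L x" if "norm x = 1" for x
      using that by simp
    have "ball 0 (section_volume L x0) \<subseteq> intersection_body L"
    proof
      fix y :: 'a assume y: "y \<in> ball 0 (section_volume L x0)"
      show "y \<in> intersection_body L"
      proof (cases "y = 0")
        case True
        then show ?thesis using b section_volume_pos[OF L, of b]
          by (auto simp: intersection_body_def intro!: exI[of _ 0] exI[of _ b])
      next
        case False
        then have s: "y = norm y *\<^sub>R sgn y" "norm (sgn y) = 1" by (auto simp: sgn_div_norm)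
        then show ?thesis using y x0[OF s(2)]
          by (auto simp: intersection_body_def intro!: exI[of _ "norm y"] exI[of _ "sgn y"])
      qed
    qed
    then show ?thesis using section_volume_pos[OF L, of x0] by (auto simp: mem_interior)
  qed
  ultimately show ?thesis by (simp add: starbody_def)
qed

text \<open>The polynomial \<open>Q\<close> serves twice: it represents the radial function, and it
  supplies the continuity that makes the intersection body a starbody.\<close>

lemma polyradial_intersection_body:
  fixes L :: "'a::euclidean_space set"
  assumes L: "polyradial L" and n: "DIM('a) \<ge> 2"
  shows "polyradial (intersection_body L)"
proof -
  obtain Q where Q: "real_polynomial_function Q" "\<And>x. norm x = 1 \<Longrightarrow> section_volume L x = Q x"
    using section_volume_polynomial[OF L n] by blast
  have sL: "starbody L" using L by (simp add: polyradial_def)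
  have "continuous_on (sphere 0 1) Q"
    using Q(1) by (intro continuous_at_imp_continuous_on ballI continuous_real_polymonial_function)
  then have "continuous_on (sphere 0 1) (section_volume L)"
    by (rule continuous_on_eq) (simp add: Q(2))
  then have "starbody (intersection_body L)" by (rule starbody_intersection_body[OF sL])
  moreover have "\<forall>x\<in>sphere 0 1. radial_function (intersection_body L) x = Q x"
    by (simp add: radial_function_intersection_body[OF sL] Q(2))
  ultimately show ?thesis using Q(1) unfolding polyradial_def by blast
qed

theorem theorem5p1:
  fixes L :: "(real ^ 'n) set"
  assumes "CARD('n) \<ge> 2"
    and "polyradial L"
  shows "polyradial (intersection_body L)"
  using assms by (intro polyradial_intersection_body) simp_all

end
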